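(* Let $X_G$ be the two-dimensional shift of finite type generated by a two-dimensional graph $G=(H,V)$, with associated sets $A_1,A_2$ of triangular patterns and associated matrices $M$ (indexed by $A_1$) and $N$ (indexed by $A_2$). Suppose that the sequence spaces generated by $M$ and by $N$ are non-empty. If for all $k,l\in A_2$ with $N_{kl}\neq 0$ and every E-pair $k_1\in A_1$ of $k$ there exists an E-pair $l_1\in A_1$ of $l$ such that $M_{k_1l_1}\neq 0$, then $X_G\neq\emptyset$.
   Context: A two-dimensional graph is a pair $G=(H,V)$ of directed graphs (at most one edge for each ordered pair of vertices, loops allowed) on a common finite vertex set $\mathcal{V}$; $H$ and $V$ also denote their $0$-$1$ adjacency matrices. The shift space generated by $G$ is $$X_G=\{x\in\mathcal{V}^{\mathbb{Z}^2}: H_{x(i,j),x(i+1,j)}=1 \text{ and } V_{x(i,j),x(i,j+1)}=1 \text{ for all } (i,j)\in\mathbb{Z}^2\}.$$ A $2\times 2$ pattern with bottom row $p\,q$ and top row $r\,s$ (left to right) is allowed if $H_{pq}=H_{rs}=V_{pr}=V_{qs}=1$. $A_1$ is the set of triples $(a,b,c)\in\mathcal{V}^3$, regarded as triangular patterns with $a$ bottom-left, $b$ bottom-right, $c$ top-right, for which there is $d\in\mathcal{V}$ such that the $2\times2$ pattern with bottom row $a\,b$ and top row $d\,c$ is allowed. $A_2$ is the set of triples $(x,y,z)\in\mathcal{V}^3$, regarded as triangular patterns with $x$ bottom-left, $y$ top-left, $z$ top-right, for which there is $w\in\mathcal{V}$ such that the $2\times 2$ pattern with bottom row $x\,w$ and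 top row $y\,z$ is allowed. $M$ is the $0$-$1$ matrix indexed by $A_1$ with $M_{IJ}=1$ if and only if $I=(a_1,a_2,a_3)$, $J=(a_3,a_4,a_5)$ (the last entry of $I$ equals the first entry of $J$) and $(a_2,a_3,a_4)\in A_2$. $N$ is the $0$-$1$ matrix indexed by $A_2$ with $N_{RS}=1$ if and only if $R=(b_1,b_2,b_3)$, $S=(b_3,b_4,b_5)$ (the last entry of $R$ equals the first entry of $S$) and $(b_2,b_3,b_4)\in A_1$. The sequence space generated by a $0$-$1$ matrix $B$ with index set $\mathcal{I}$ is the set of all bi-infinite sequences $(t_n)_{n\in\mathbb{Z}}\in\mathcal{I}^{\mathbb{Z}}$ with $B_{t_nt_{n+1}}=1$ for all $n$. An element $I=(a_1,a_2,a_3)\in A_1$ and an element $J=(x,y,z)\in A_2$ form an E-pair (each is called an E-pair of the other) if $x=a_1$ and $z=a_3$, i.e. if they have the same bottom-left and the same top-right symbols. *)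

theory Defs
  imports "Graph_Theory.Pair_Digraph"
begin

text \<open>Locale \<^locale>\<open>pair_fin_digraph\<close> describes finite digraphs whose arcs are ordered pairs of
  vertices: no parallel arcs, loops allowed.\<close>

locale two_dim_graph = H: pair_fin_digraph H + V: pair_fin_digraph V
  for H V :: "'a pair_pre_digraph" +
  assumes same_verts: "pverts H = pverts V"

definition adj :: "'a pair_pre_digraph \<Rightarrow> 'a \<Rightarrow> 'a \<Rightarrow> nat" where
  "adj D p q = (if (p, q) \<in> parcs D then 1 else 0)"

definition shift_space :: "'a pair_pre_digraph \<Rightarrow> 'a pair_pre_digraph \<Rightarrow> (int \<times> int \<Rightarrow> 'a) set" where
  "shift_space H V = {x. (\<forall>i j. x (i, j) \<in> pverts H) \<and>
     (\<forall>i j. adj H (x (i, j)) (x (i + 1, j)) = 1 \<and> adj V (x (i, j)) (x (i, j + 1)) = 1)}"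

text \<open>The arguments \<open>p q r s\<close> are the bottom row \<open>p q\<close> followed by the top row \<open>r s\<close>.\<close>

definition allowed :: "'a pair_pre_digraph \<Rightarrow> 'a pair_pre_digraph \<Rightarrow> 'a \<Rightarrow> 'a \<Rightarrow> 'a \<Rightarrow> 'a \<Rightarrow> bool" where
  "allowed H V p q r s \<longleftrightarrow> adj H p q = 1 \<and> adj H r s = 1 \<and> adj V p r = 1 \<and> adj V q s = 1"

text \<open>Triples in \<open>A1\<close> list the bottom-left, bottom-right and top-right symbols; triples in \<open>A2\<close>
  list the bottom-left, top-left and top-right symbols.\<close>

definition A1 :: "'a pair_pre_digraph \<Rightarrow> 'a pair_pre_digraph \<Rightarrow> ('a \<times> 'a \<times> 'a) set" where
  "A1 H V = {(a, b, c). a \<in> pverts H \<and> b \<in> pverts H \<and> c \<in> pverts H \<and>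
     (\<exists>d \<in> pverts H. allowed H V a b d c)}"

definition A2 :: "'a pair_pre_digraph \<Rightarrow> 'a pair_pre_digraph \<Rightarrow> ('a \<times> 'a \<times> 'a) set" where
  "A2 H V = {(x, y, z). x \<in> pverts H \<and> y \<in> pverts H \<and> z \<in> pverts H \<and>
     (\<exists>w \<in> pverts H. allowed H V x w y z)}"

text \<open>Matrices are functions of two indices; only their values on the index set, \<open>A1\<close> for \<open>M\<close>
  and \<open>A2\<close> for \<open>N\<close>, are meaningful.\<close>

fun M_mat :: "'a pair_pre_digraph \<Rightarrow> 'a pair_pre_digraph \<Rightarrow>
    'a \<times> 'a \<times> 'a \<Rightarrow> 'a \<times> 'a \<times> 'a \<Rightarrow> nat" where
  "M_mat H V (a1, a2, a3) (a3', a4, a5) = (if a3 = a3' \<and> (a2, a3, a4) \<in> A2 H V then 1 else 0)"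

fun N_mat :: "'a pair_pre_digraph \<Rightarrow> 'a pair_pre_digraph \<Rightarrow>
    'a \<times> 'a \<times> 'a \<Rightarrow> 'a \<times> 'a \<times> 'a \<Rightarrow> nat" where
  "N_mat H V (b1, b2, b3) (b3', b4, b5) = (if b3 = b3' \<and> (b2, b3, b4) \<in> A1 H V then 1 else 0)"

definition sequence_space :: "'i set \<Rightarrow> ('i \<Rightarrow> 'i \<Rightarrow> nat) \<Rightarrow> (int \<Rightarrow> 'i) set" where
  "sequence_space I B = {t. (\<forall>n. t n \<in> I) \<and> (\<forall>n. B (t n) (t (n + 1)) = 1)}"

text \<open>Meaningful for one triple in \<open>A1\<close> and the other in \<open>A2\<close>: in both sets the first and last
  entries are the bottom-left and top-right symbols.\<close>

fun E_pair :: "'a \<times> 'a \<times> 'a \<Rightarrow> 'a \<times> 'a \<times> 'a \<Rightarrow> bool" where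
  "E_pair (a1, a2, a3) (x, y, z) \<longleftrightarrow> x = a1 \<and> z = a3"

end

theory Submission
  imports Defs "HOL-Analysis.Function_Topology"
begin

text \<open>
  The idea is to fill an octant of the plane one diagonal at a time. Two neighbouring diagonals
  together form a staircase, with steps alternately to the right and up; a point of the sequence
  space of \<open>M\<close> is such a staircase, all of whose corners lie in \<open>A1\<close> or \<open>A2\<close>. Read from its
  second diagonal on, the same staircase is a sequence for \<open>N\<close>, and the hypothesis on E-pairs
  allows the next diagonal below it to be chosen cell by cell
  (\<open>staircase_extend\<close>). A one-sided staircase is enough for this: the first cell of the new diagonal
  completes an \<open>A2\<close> corner to an allowed square, and each later cell is chosen after its
  predecessor. Iterating fills the octant of all cells \<open>(i, j)\<close> with \<open>0 \<le> j \<le> i\<close>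
  (\<open>octant_filling\<close>).

  The octant contains translates of every finite subset of the plane, so every finite part of the
  adjacency constraints is satisfiable. As there are finitely many symbols, compactness
  (\<open>binary_constraints_compactness\<close>) yields a point of the shift space.
\<close>

text \<open>The assignments form a compact space by Tychonoff's theorem, and each constraint cuts out a
  closed set because it looks at two coordinates only.\<close>

lemma binary_constraints_compactness:
  fixes R :: "'i \<Rightarrow> 'i \<Rightarrow> 'a \<Rightarrow> 'a \<Rightarrow> bool"
  assumes "finite S"
    and local: "\<And>F. finite F \<Longrightarrow>
      \<exists>x. (\<forall>i. x i \<in> S) \<and> (\<forall>a\<in>F. \<forall>b\<in>F. R a b (x a) (x b))"
  shows "\<exists>x. (\<forall>i. x i \<in> S) \<and> (\<forall>a b. R a b (x a) (x b))"
proof -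
  define X where "X = product_topology (\<lambda>_::'i. discrete_topology S) UNIV"
  define C where "C = (\<lambda>(a, b). {x \<in> topspace X. R a b (x a) (x b)})"
  have X_points: "x \<in> topspace X \<longleftrightarrow> (\<forall>i. x i \<in> S)" for x
    by (auto simp: X_def PiE_def)
  have "compact_space X"
    using \<open>finite S\<close>
    by (simp add: X_def compact_space_product_topology compact_space_discrete_topology)
  moreover have "closedin X D" if D: "D \<in> range C" for D
  proof -
    obtain a b where "D = C (a, b)"
      using D by auto
    have cylinder: "closedin X {x \<in> topspace X. x i \<in> {p}}" if "p \<in> S" for i p
      by (rule closedin_continuous_map_preimage[of X "discrete_topology S" "\<lambda>x. x i"])
        (use that in \<open>auto simp: X_def intro: continuous_map_product_projection\<close>)
    have "D = (\<Union>(p, q) \<in> {(p, q) \<in> S \<times> S. R a b p q}.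
        {x \<in> topspace X. x a \<in> {p}} \<inter> {x \<in> topspace X. x b \<in> {q}})"
      unfolding \<open>D = C (a, b)\<close> C_def by (auto simp: X_points)
    moreover have "closedin X \<dots>"
      by (rule closedin_Union)
        (use \<open>finite S\<close> in \<open>auto intro!: closedin_Int cylinder[simplified]
          intro: finite_subset[of _ "S \<times> S"]\<close>)
    ultimately show ?thesis
      by simp
  qed
  moreover have "\<Inter>\<F> \<noteq> {}" if \<F>: "finite \<F>" "\<F> \<subseteq> range C" for \<F>
  proof -
    obtain P where P: "finite P" "\<F> = C ` P"
      using finite_subset_image[OF \<F>] by auto
    obtain x where "\<forall>i. x i \<in> S" "\<forall>a\<in>fst ` P \<union> snd ` P. \<forall>b\<in>fst ` P \<union> snd ` P. R a b (x a) (x b)"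
      using local[of "fst ` P \<union> snd ` P"] P(1) by auto
    then have "x \<in> \<Inter>\<F>"
      unfolding P(2) C_def by (force simp: X_points)
    then show ?thesis
      by blast
  qed
  ultimately have "\<Inter>(range C) \<noteq> {}"
    unfolding compact_space_fip by blast
  then obtain x where "\<forall>ab. x \<in> C ab"
    by auto
  then show ?thesis
    by (force simp: C_def X_points)
qed

text \<open>The symbol \<open>f n\<close> is followed by \<open>g n\<close> on its right, and \<open>g n\<close> by \<open>f (n + 1)\<close> above it: \<open>f\<close> and
  \<open>g\<close> are neighbouring diagonals, \<open>g\<close> being the lower right one.\<close>

definition staircase ::
    "'a pair_pre_digraph \<Rightarrow> 'a pair_pre_digraph \<Rightarrow> (nat \<Rightarrow> 'a) \<Rightarrow> (nat \<Rightarrow> 'a) \<Rightarrow> bool" where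
  "staircase H V f g \<longleftrightarrow>
    (\<forall>n. (f n, g n, f (Suc n)) \<in> A1 H V \<and> (g n, f (Suc n), g (Suc n)) \<in> A2 H V)"

lemma M_sequence_imp_staircase:
  assumes "t \<in> sequence_space (A1 H V) (M_mat H V)"
  shows "\<exists>f g. staircase H V f g"
proof -
  define f where "f n = fst (t (int n))" for n
  define g where "g n = fst (snd (t (int n)))" for n
  have "(f n, g n, f (Suc n)) \<in> A1 H V \<and> (g n, f (Suc n), g (Suc n)) \<in> A2 H V" for n
  proof -
    obtain a b c where t0: "t (int n) = (a, b, c)"
      by (cases "t (int n)")
    obtain a' b' c' where t1: "t (int n + 1) = (a', b', c')"
      by (cases "t (int n + 1)")
    have "(a, b, c) \<in> A1 H V" "M_mat H V (a, b, c) (a', b', c') = 1"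
      using assms t0 t1 unfolding sequence_space_def by (metis (mono_tags, lifting) mem_Collect_eq)+
    then show ?thesis
      using t0 t1 by (auto simp: f_def g_def add.commute split: if_splits)
  qed
  then show ?thesis
    unfolding staircase_def by blast
qed

text \<open>The corners \<open>(g n, f (n + 1), g (n + 1))\<close> of a staircase form a sequence for \<open>N\<close>. The new
  diagonal consists of the middle symbols of a sequence of E-pairs of these corners that is
  compatible with \<open>M\<close>.\<close>

lemma staircase_extend:
  assumes E_step: "\<forall>k \<in> A2 H V. \<forall>l \<in> A2 H V. N_mat H V k l \<noteq> 0 \<longrightarrow>
           (\<forall>k1 \<in> A1 H V. E_pair k1 k \<longrightarrow>
             (\<exists>l1 \<in> A1 H V. E_pair l1 l \<and> M_mat H V k1 l1 \<noteq> 0))"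
    and fg: "staircase H V f g"
  shows "\<exists>h. staircase H V g h"
proof -
  have corner: "(g n, f (Suc n), g (Suc n)) \<in> A2 H V" for n
    using fg by (simp add: staircase_def)
  have N_step: "N_mat H V (g n, f (Suc n), g (Suc n))
      (g (Suc n), f (Suc (Suc n)), g (Suc (Suc n))) \<noteq> 0" for n
    using fg by (simp add: staircase_def)
  have "\<exists>h. \<forall>n. (g n, h n, g (Suc n)) \<in> A1 H V \<and> (h n, g (Suc n), h (Suc n)) \<in> A2 H V"
  proof (rule dependent_nat_choice)
    \<comment> \<open>the symbol that completes the first corner to an allowed square\<close>
    show "\<exists>w. (g 0, w, g (Suc 0)) \<in> A1 H V"
      using corner[of 0] unfolding A1_def A2_def by blast
  next
    fix w n
    assume "(g n, w, g (Suc n)) \<in> A1 H V"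
    then obtain l1 where "l1 \<in> A1 H V"
      "E_pair l1 (g (Suc n), f (Suc (Suc n)), g (Suc (Suc n)))"
      "M_mat H V (g n, w, g (Suc n)) l1 \<noteq> 0"
      using E_step corner N_step[of n] by (meson E_pair.simps)
    then show "\<exists>w'. (g (Suc n), w', g (Suc (Suc n))) \<in> A1 H V \<and> (w, g (Suc n), w') \<in> A2 H V"
      by (cases l1) (auto split: if_splits)
  qed
  then show ?thesis
    unfolding staircase_def .
qed

text \<open>Here \<open>D k n\<close> is the symbol in cell \<open>(n + k, n)\<close>, the \<open>n\<close>-th cell of the \<open>k\<close>-th diagonal.\<close>

lemma octant_filling:
  assumes "staircase H V f g"
    and extend: "\<And>f g. staircase H V f g \<Longrightarrow> \<exists>h. staircase H V g h"
  obtains D where "\<And>k. staircase H V (D k) (D (Suc k))"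
proof -
  have "\<exists>F. \<forall>k. staircase H V (fst (F k)) (snd (F k)) \<and> fst (F (Suc k)) = snd (F k)"
    using assms(1) extend
    by (intro dependent_nat_choice) (metis fst_conv snd_conv)+
  then obtain F where "\<forall>k. staircase H V (fst (F k)) (snd (F k)) \<and> fst (F (Suc k)) = snd (F k)"
    by blast
  then show thesis
    using that[of "\<lambda>k. fst (F k)"] by simp
qed

lemma A1_adj:
  assumes "(a, b, c) \<in> A1 H V"
  shows "a \<in> pverts H" "adj H a b = 1" "adj V b c = 1"
  using assms by (auto simp: A1_def allowed_def)

theorem corollary8:
  fixes H V :: "'a pair_pre_digraph"
  assumes "two_dim_graph H V"
    and "sequence_space (A1 H V) (M_mat H V) \<noteq> {}"
    and "sequence_space (A2 H V) (N_mat H V) \<noteq> {}"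
    and "\<forall>k \<in> A2 H V. \<forall>l \<in> A2 H V. N_mat H V k l \<noteq> 0 \<longrightarrow>
           (\<forall>k1 \<in> A1 H V. E_pair k1 k \<longrightarrow>
             (\<exists>l1 \<in> A1 H V. E_pair l1 l \<and> M_mat H V k1 l1 \<noteq> 0))"
  shows "shift_space H V \<noteq> {}"
proof -
  interpret two_dim_graph H V by fact
  obtain f g where "staircase H V f g"
    using assms(2) M_sequence_imp_staircase by blast
  then obtain D where "\<And>k. staircase H V (D k) (D (Suc k))"
    using octant_filling staircase_extend[OF assms(4)] by metis
  \<comment> \<open>These corners alone cover every horizontal and vertical adjacency inside the octant.\<close>
  then have D: "(D k n, D (Suc k) n, D k (Suc n)) \<in> A1 H V" for k n
    by (simp add: staircase_def)
  define R where "R = (\<lambda>(a :: int \<times> int) b p q.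
      (b = (fst a + 1, snd a) \<longrightarrow> adj H p q = 1) \<and>
      (b = (fst a, snd a + 1) \<longrightarrow> adj V p q = 1))"
  have "\<exists>x. (\<forall>i. x i \<in> pverts H) \<and> (\<forall>a\<in>F. \<forall>b\<in>F. R a b (x a) (x b))"
    if "finite F" for F :: "(int \<times> int) set"
  proof -
    have "\<exists>m. \<forall>c\<in>F. \<bar>fst c\<bar> \<le> m \<and> \<bar>snd c\<bar> \<le> m"
      using that
    proof induction
      case (insert c F)
      then obtain m where "\<forall>c\<in>F. \<bar>fst c\<bar> \<le> m \<and> \<bar>snd c\<bar> \<le> m" by blast
      then show ?case
        by (intro exI[of _ "max m (max \<bar>fst c\<bar> \<bar>snd c\<bar>)"]) auto
    qed simp
    then obtain m where m: "\<bar>fst c\<bar> \<le> m" "\<bar>snd c\<bar> \<le> m" if "c \<in> F" for c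
      by blast
    \<comment> \<open>Translating by \<open>(3 * m, m)\<close> moves the square \<open>[-m, m]\<close> x \<open>[-m, m]\<close> into the octant:
      there \<open>j + m \<ge> 0\<close> and \<open>(i + 3 * m) - (j + m) \<ge> 0\<close>.\<close>
    define x where "x = (\<lambda>(i, j). D (nat (i - j + 2 * m)) (nat (j + m)))"
    have "x c \<in> pverts H" for c
      using A1_adj(1)[OF D] by (cases c) (simp add: x_def)
    moreover have "R a b (x a) (x b)" if "a \<in> F" "b \<in> F" for a b
    proof -
      obtain i j where a: "a = (i, j)" by (cases a)
      have "adj H (x (i, j)) (x (i + 1, j)) = 1"
      proof -
        have "nat (i + 1 - j + 2 * m) = Suc (nat (i - j + 2 * m))"
          using m[OF \<open>a \<in> F\<close>] a by auto
        then show ?thesis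
          using A1_adj(2)[OF D] by (simp add: x_def)
      qed
      moreover have "adj V (x (i, j)) (x (i, j + 1)) = 1" if "b = (i, j + 1)"
      proof -
        have "nat (i - j + 2 * m) = Suc (nat (i - (j + 1) + 2 * m))"
          "nat (j + 1 + m) = Suc (nat (j + m))"
          using m[OF \<open>a \<in> F\<close>] m[OF \<open>b \<in> F\<close>] a that by auto
        then show ?thesis
          using A1_adj(3)[OF D] by (simp add: x_def)
      qed
      ultimately show ?thesis
        by (auto simp: R_def a)
    qed
    ultimately show ?thesis
      by blast
  qed
  then obtain x where "\<forall>c. x c \<in> pverts H" "\<forall>a b. R a b (x a) (x b)"
    using binary_constraints_compactness[OF H.pair_finite_verts] by metis
  then have "x \<in> shift_space H V"
    by (simp add: shift_space_def R_def)
  then show ?thesis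
    by blast
qed

end
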